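(* Let $\alpha$ be an irrational number, and assume that $\inf_{q\ge1}q^c\|q\alpha\|>0$ with some constant $1\le c<2$, where $q$ ranges over positive integers. Then for all integers $N\ge1$, \[ P_N(\alpha)\ll\prod_{n=1}^N\left(2e\|n\alpha\|\right)\ll P_N(\alpha) \] with implied (positive) constants depending only on $\alpha$.
   Context: The Sudler product is $P_N(\alpha)=\prod_{n=1}^N|2\sin(\pi n\alpha)|$; $\|\cdot\|$ denotes the distance from the nearest integer; $e$ is Euler's number. $X\ll Y$ means $|X|\le CY$ with an implied constant $C>0$. *)

theory Defs
  imports "HOL-Analysis.Analysis"
begin

definition dist_nearest_int :: "real \<Rightarrow> real" where
  "dist_nearest_int x = infdist x \<int>"

definition sudler_product :: "nat \<Rightarrow> real \<Rightarrow> real" where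
  "sudler_product N \<alpha> = (\<Prod>n=1..N. \<bar>2 * sin (pi * real n * \<alpha>)\<bar>)"

end

theory Submission
  imports Defs
begin

text \<open>
  Write $d_n$ for the distance of $n\alpha$ from the nearest integer. Since
  $|\sin(\pi n\alpha)| = \sin(\pi d_n)$, the two products differ by the factor
  $\exp\bigl(\sum_{n\le N} f(d_n)\bigr)$ with $f(x) = 1 - \ln(\sin(\pi x)/x)$. Both estimates therefore
  say exactly that the sums $\sum_{n\le N} f(d_n)$ are bounded uniformly in $N$. The constant $e$ is the
  one that makes this possible: it gives $f$ mean zero on $[0,1/2]$
  (\<open>has_integral_ln_sin_quotient\<close>).

  The function $x \mapsto f(d(x))$, with $d$ the distance from the nearest integer, is even,
  1-periodic and continuous, and $f'$ is monotone and bounded on $(0,1/2]$. Hence its cosine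
  coefficients $a_k$ are $O(1/k^2)$ (\<open>cosine_coefficient_bound\<close>) and its cosine series
  converges to it at every point (\<open>cosine_expansion\<close>). Summing the series along the
  rotation turns each $\cos(2\pi k x)$ into a geometric-type sum that is at most
  $1/|\sin(\pi k\alpha)|$, uniformly in $N$; there is no term with $k = 0$ because of the mean zero. So
  everything reduces to the convergence of $\sum_k 1/(k^2 d_k)$.

  This is where the Diophantine condition with exponent $c < 2$ enters
  (\<open>summable_inverse_square_dist\<close>). The numbers $d_k$ with $k \le K$ are bounded below by,
  and separated from each other by, some $\delta$ of order $K^{-c}$. Hence they are no smaller than
  distinct positive integer multiples of $\delta$, and $\sum_{k\le K} d_k^{-s} = O(K^{cs})$ for every
  $s > 1$. If $s$ is so close to 1 that $cs < 2$, the dyadic blocks of $\sum_k 1/(k^2 d_k)$ decay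
  geometrically.
\<close>

section \<open>Cosine series on half a period\<close>

lemma has_integral_cos_half_period:
  fixes m :: int
  shows "((\<lambda>x. cos (2 * pi * m * x)) has_integral (if m = 0 then 1/2 else 0)) {0..1/2::real}"
proof (cases "m = 0")
  case True
  then show ?thesis using has_integral_const_real[of "1::real" 0 "1/2"] by simp
next
  case False
  have "((\<lambda>x. cos (2 * pi * m * x)) has_integral
      (sin (2 * pi * m * (1/2)) / (2 * pi * m) - sin (2 * pi * m * 0) / (2 * pi * m))) {0..1/2}"
    using False
    by (intro fundamental_theorem_of_calculus)
       (auto intro!: derivative_eq_intros simp flip: has_real_derivative_iff_has_vector_derivative)
  moreover have "sin (2 * pi * m * (1/2)) = 0"
    using sin_npi_int[of m] by (simp add: mult_ac)
  ultimately show ?thesis using False by simp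
qed

lemma has_integral_cos_cos_half_period:
  fixes j k :: nat
  assumes "k \<ge> 1"
  shows "((\<lambda>x. cos (2 * pi * real k * x) * cos (2 * pi * real j * x))
           has_integral (if j = k then 1/4 else 0)) {0..1/2::real}"
proof -
  have "((\<lambda>x. (cos (2 * pi * (int k - int j) * x) + cos (2 * pi * (int k + int j) * x)) / 2)
      has_integral ((if int k - int j = 0 then 1/2 else 0) + (if int k + int j = 0 then 1/2 else 0)) / 2)
      {0..1/2::real}"
    by (intro has_integral_divide has_integral_add)
       (use has_integral_cos_half_period[of "int k - int j"] has_integral_cos_half_period[of "int k + int j"]
        in \<open>simp_all only:\<close>)
  moreover have "(cos (2 * pi * (int k - int j) * x) + cos (2 * pi * (int k + int j) * x)) / 2
      = cos (2 * pi * real k * x) * cos (2 * pi * real j * x)" for x :: real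
    by (simp add: algebra_simps cos_diff cos_add)
  ultimately show ?thesis using assms by (auto split: if_splits)
qed

text \<open>
  By the product formula for cosines, $u$ is orthogonal to every polynomial in $\cos(2\pi x)$, not only
  to the functions $\cos(2\pi k x)$. On $[0,1/2]$ the map $x \mapsto \cos(2\pi x)$ is a homeomorphism
  onto $[-1,1]$, so by Weierstrass these polynomials approximate $u$ itself uniformly, which forces
  $\int u^2 = 0$.
\<close>

lemma cosine_coefficients_zero_imp_zero:
  fixes u :: "real \<Rightarrow> real"
  assumes u: "continuous_on {0..1/2} u"
    and coeff: "\<And>k::nat. integral {0..1/2} (\<lambda>x. u x * cos (2 * pi * real k * x)) = 0"
    and x: "x \<in> {0..1/2}"
  shows "u x = 0"
proof -
  have int: "(\<lambda>x. u x * g x) integrable_on {0..1/2}" if "continuous_on {0..1/2} g" for g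
    using u that by (intro integrable_continuous_real continuous_intros)
  have pow: "integral {0..1/2} (\<lambda>x. u x * (cos (2 * pi * x) ^ i * cos (2 * pi * real k * x))) = 0"
    for i k
  proof (induction i arbitrary: k)
    case 0
    then show ?case using coeff by simp
  next
    case (Suc i)
    \<comment> \<open>The frequency $|k - 1|$, which equals $1$ for $k = 0$.\<close>
    define k' where "k' = (if k = 0 then 1 else k - 1)"
    have prod: "cos (2 * pi * x) * cos (2 * pi * real k * x)
        = (cos (2 * pi * real (k + 1) * x) + cos (2 * pi * real k' * x)) / 2" for x :: real
      by (auto simp: k'_def cos_times_cos algebra_simps of_nat_diff)
        (metis cos_minus minus_diff_eq)
    have "u x * (cos (2 * pi * x) ^ Suc i * cos (2 * pi * real k * x))
        = (u x * (cos (2 * pi * x) ^ i * cos (2 * pi * real (k + 1) * x))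
           + u x * (cos (2 * pi * x) ^ i * cos (2 * pi * real k' * x))) / 2" for x
    proof -
      have "u x * (cos (2 * pi * x) ^ Suc i * cos (2 * pi * real k * x))
          = u x * (cos (2 * pi * x) ^ i * (cos (2 * pi * x) * cos (2 * pi * real k * x)))"
        by (simp only: power_Suc mult_ac)
      then show ?thesis
        unfolding prod by (simp only: distrib_left times_divide_eq_right)
    qed
    moreover have "integral {0..1/2}
        (\<lambda>x. (u x * (cos (2 * pi * x) ^ i * cos (2 * pi * real (k + 1) * x))
           + u x * (cos (2 * pi * x) ^ i * cos (2 * pi * real k' * x))) / 2) = 0"
      using Suc.IH[of "k + 1"] Suc.IH[of k']
      by (subst integral_divide, subst integral_add)
         (auto intro!: int continuous_intros)
    ultimately show ?case by (simp only:)
  qed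
  have poly: "integral {0..1/2} (\<lambda>x. u x * p (cos (2 * pi * x))) = 0"
    if "real_polynomial_function p" for p
  proof -
    obtain a n where p: "p = (\<lambda>x. \<Sum>i\<le>n. a i * x ^ i)"
      using \<open>real_polynomial_function p\<close> real_polynomial_function_imp_sum by blast
    have "integral {0..1/2} (\<lambda>x. \<Sum>i\<le>n. u x * (cos (2 * pi * x) ^ i) * a i)
        = (\<Sum>i\<le>n. integral {0..1/2} (\<lambda>x. u x * (cos (2 * pi * x) ^ i) * a i))"
      by (intro integral_sum) (auto intro!: integrable_on_mult_left int continuous_intros)
    also have "\<dots> = 0"
      using pow[of _ 0] by simp
    finally show ?thesis
      by (simp add: p sum_distrib_left mult_ac)
  qed
  obtain B where B: "B > 0" "\<And>x. x \<in> {0..1/2} \<Longrightarrow> \<bar>u x\<bar> \<le> B"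
  proof -
    have "bounded (u ` {0..1/2})"
      using u compact_continuous_image compact_imp_bounded by blast
    then show ?thesis using that unfolding bounded_pos by (auto simp: real_norm_def)
  qed
  have small: "\<bar>integral {0..1/2} (\<lambda>x. u x * u x)\<bar> \<le> e" if e: "e > 0" for e
  proof -
    have "continuous_on {-1..1::real} (\<lambda>y. u (arccos y / (2 * pi)))"
      by (intro continuous_on_compose2[OF u] continuous_intros)
         (auto simp: divide_simps arccos_bounded arccos_lbound mult_ac arccos_ubound)
    from Stone_Weierstrass_real_polynomial_function[OF compact_Icc this, of "e / B"]
    obtain p where p: "real_polynomial_function p"
      "\<And>y. y \<in> {-1..1} \<Longrightarrow> \<bar>u (arccos y / (2 * pi)) - p y\<bar> < e / B"
      using B(1) e by auto
    have close: "\<bar>u x - p (cos (2 * pi * x))\<bar> < e / B" if "x \<in> {0..1/2}" for x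
    proof -
      have "arccos (cos (2 * pi * x)) = 2 * pi * x"
        using that by (intro arccos_cos) auto
      then show ?thesis using p(2)[of "cos (2 * pi * x)"] by simp
    qed
    have "continuous_on UNIV p"
      using p(1) by (simp add: continuous_at_imp_continuous_on continuous_real_polymonial_function)
    then have contp: "continuous_on {0..1/2} (\<lambda>x. p (cos (2 * pi * x)))"
      by (rule continuous_on_compose2) (auto intro!: continuous_intros)
    have "integral {0..1/2} (\<lambda>x. u x * u x) - 0
        = integral {0..1/2} (\<lambda>x. u x * (u x - p (cos (2 * pi * x))))"
      using int[OF u] int[OF contp] by (subst poly[OF p(1), symmetric])
        (simp add: right_diff_distrib integral_diff)
    moreover have "norm (integral {0..1/2} (\<lambda>x. u x * (u x - p (cos (2 * pi * x))))) \<le> e * (1/2 - 0)"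
    proof (rule integral_bound)
      show "continuous_on {0..1/2} (\<lambda>x. u x * (u x - p (cos (2 * pi * x))))"
        using u contp by (intro continuous_intros)
      fix t :: real assume t: "t \<in> {0..1/2}"
      have "\<bar>u t\<bar> * \<bar>u t - p (cos (2 * pi * t))\<bar> \<le> B * (e / B)"
        using B close[OF t] t by (intro mult_mono) (auto intro: less_imp_le)
      then show "norm (u t * (u t - p (cos (2 * pi * t)))) \<le> e"
        using B(1) by (simp add: abs_mult)
    qed auto
    ultimately show ?thesis using e by simp
  qed
  have "integral {0..1/2} (\<lambda>x. u x * u x) = 0"
    using small field_le_epsilon[of "\<bar>integral {0..1/2} (\<lambda>x. u x * u x)\<bar>" 0] by auto
  moreover have "continuous_on {0..1/2} (\<lambda>x. u x * u x)"
    using u by (intro continuous_intros)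
  ultimately have "\<forall>x\<in>{0..1/2}. u x * u x = 0"
    by (subst (asm) integral_eq_0_iff) auto
  then show ?thesis using x by simp
qed

text \<open>
  The series converges uniformly, so its sum is continuous and has the same cosine coefficients as
  $f$; the difference vanishes by uniqueness. Half a period is enough because an even 1-periodic
  function is determined by it. This is also where the factor 4 comes from:
  $\int_0^{1/2} \cos^2(2\pi k x)\,dx = 1/4$.
\<close>

lemma cosine_expansion:
  fixes f :: "real \<Rightarrow> real"
  defines "a \<equiv> \<lambda>k::nat. integral {0..1/2} (\<lambda>x. f x * cos (2 * pi * real k * x))"
  assumes f: "continuous_on {0..1/2} f"
    and mean: "integral {0..1/2} f = 0"
    and sm: "summable (\<lambda>k. \<bar>a (Suc k)\<bar>)"
    and x: "x \<in> {0..1/2}"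
  shows "(\<lambda>k. 4 * a (Suc k) * cos (2 * pi * real (Suc k) * x)) sums f x"
proof -
  define F where "F = (\<lambda>x. \<Sum>k. 4 * a (Suc k) * cos (2 * pi * real (Suc k) * x))"
  have bnd: "norm (4 * a (Suc k) * cos (2 * pi * real (Suc k) * x)) \<le> 4 * \<bar>a (Suc k)\<bar>" for k x
    by (simp add: abs_mult mult_left_le)
  have sm4: "summable (\<lambda>k. 4 * \<bar>a (Suc k)\<bar>)"
    using sm by (rule summable_mult)
  have smx: "summable (\<lambda>k. 4 * a (Suc k) * cos (2 * pi * real (Suc k) * x))" for x
    by (rule summable_comparison_test[OF _ sm4]) (use bnd in blast)
  have lim: "uniform_limit {0..1/2} (\<lambda>n x. \<Sum>k<n. 4 * a (Suc k) * cos (2 * pi * real (Suc k) * x))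
      F sequentially"
    unfolding F_def by (rule Weierstrass_m_test[OF bnd sm4])
  have contF: "continuous_on {0..1/2} F"
    by (rule uniform_limit_theorem[OF _ lim]) (auto intro!: always_eventually continuous_intros)
  have coeffF: "integral {0..1/2} (\<lambda>x. F x * cos (2 * pi * real j * x)) = a j" for j
  proof -
    have bnd': "norm (4 * a (Suc k) * cos (2 * pi * real (Suc k) * x) * cos (2 * pi * real j * x))
        \<le> 4 * \<bar>a (Suc k)\<bar>" for k x
      using bnd[of k x] mult_right_le_one_le[of "norm (4 * a (Suc k) * cos (2 * pi * real (Suc k) * x))" "\<bar>cos (2 * pi * real j * x)\<bar>"]
      by (simp add: abs_mult)
    have "uniform_limit {0..1/2} (\<lambda>n x. \<Sum>k<n. 4 * a (Suc k) * cos (2 * pi * real (Suc k) * x) * cos (2 * pi * real j * x))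
      (\<lambda>x. \<Sum>k. 4 * a (Suc k) * cos (2 * pi * real (Suc k) * x) * cos (2 * pi * real j * x)) sequentially"
      by (rule Weierstrass_m_test[OF bnd' sm4])
    moreover have "(\<lambda>x. \<Sum>k. 4 * a (Suc k) * cos (2 * pi * real (Suc k) * x) * cos (2 * pi * real j * x))
        = (\<lambda>x. F x * cos (2 * pi * real j * x))"
      unfolding F_def by (intro ext suminf_mult2[symmetric] smx)
    ultimately have "uniform_limit {0..1/2} (\<lambda>n x. \<Sum>k<n. 4 * a (Suc k) * cos (2 * pi * real (Suc k) * x) * cos (2 * pi * real j * x))
      (\<lambda>x. F x * cos (2 * pi * real j * x)) sequentially"
      by simp
    then obtain I J where I: "\<And>n. ((\<lambda>x. \<Sum>k<n. 4 * a (Suc k) * cos (2 * pi * real (Suc k) * x) * cos (2 * pi * real j * x)) has_integral I n) {0..1/2}"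
      and J: "((\<lambda>x. F x * cos (2 * pi * real j * x)) has_integral J) {0..1/2}"
      and IJ: "I \<longlonglongrightarrow> J"
      by (rule uniform_limit_integral) (auto intro!: continuous_intros)
    have "((\<lambda>x. \<Sum>k<n. 4 * a (Suc k) * (cos (2 * pi * real (Suc k) * x) * cos (2 * pi * real j * x)))
        has_integral (\<Sum>k<n. 4 * a (Suc k) * (if j = Suc k then 1/4 else 0))) {0..1/2}" for n
      by (intro has_integral_sum has_integral_mult_right has_integral_cos_cos_half_period) auto
    then have In: "I n = (\<Sum>k<n. 4 * a (Suc k) * (if j = Suc k then 1/4 else 0))" for n
      using I[of n] by (intro has_integral_unique[OF I[of n]]) (simp add: mult_ac)
    \<comment> \<open>The series has no constant term, so the coefficient for $j = 0$ agrees by the mean zero.\<close>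
    have a0: "a 0 = 0" using mean by (simp add: a_def)
    have "I n = a j" if "n \<ge> j" for n
    proof (cases j)
      case 0
      then show ?thesis using a0 by (simp add: In)
    next
      case (Suc i)
      then have "I n = (\<Sum>k<n. if k = i then a j else 0)"
        unfolding In by (intro sum.cong) auto
      then show ?thesis using that Suc by simp
    qed
    then have "I \<longlonglongrightarrow> a j"
      by (intro tendsto_eventually eventually_sequentiallyI)
    then have "J = a j" using IJ LIMSEQ_unique by blast
    then show ?thesis using J by blast
  qed
  have "f x - F x = 0"
  proof (rule cosine_coefficients_zero_imp_zero[OF _ _ x])
    show "continuous_on {0..1/2} (\<lambda>x. f x - F x)"
      using f contF by (intro continuous_intros)
    show "integral {0..1/2} (\<lambda>x. (f x - F x) * cos (2 * pi * real k * x)) = 0" for k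
    proof -
      have "integral {0..1/2} (\<lambda>x. f x * cos (2 * pi * real k * x) - F x * cos (2 * pi * real k * x)) = 0"
        using coeffF[of k] by (subst integral_diff)
          (auto intro!: integrable_continuous_real continuous_intros f contF simp: a_def)
      then show ?thesis by (simp add: left_diff_distrib)
    qed
  qed
  then show ?thesis
    using summable_sums[OF smx[of x]] by (simp add: F_def)
qed

text \<open>
  One integration by parts gains a factor $1/k$ and leaves $\int g(x)\sin(2\pi k x)\,dx$. As $g$ is
  monotone, the second mean value theorem gains another factor $1/k$ from the primitive of the sine.
  The integration by parts has no boundary term, since $\sin(2\pi k x)$ vanishes at both $0$ and
  $1/2$.
\<close>

lemma cosine_coefficient_bound:
  fixes f g :: "real \<Rightarrow> real"
  assumes f: "continuous_on {0..1/2} f"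
    and deriv: "\<And>x. x \<in> {0<..<1/2} \<Longrightarrow> (f has_real_derivative g x) (at x)"
    and mono: "mono_on {0..1/2} g"
    and k: "k \<ge> (1::nat)"
  shows "\<bar>integral {0..1/2} (\<lambda>x. f x * cos (2 * pi * real k * x))\<bar>
           \<le> (\<bar>g 0\<bar> + \<bar>g (1/2)\<bar>) / real k ^ 2"
proof -
  define w where "w = 2 * pi * real k"
  have w: "w > 0" using k by (simp add: w_def)
  have wk: "w \<ge> 2 * real k" using pi_ge_two k unfolding w_def
    by (simp add: mult_right_mono)
  have sin0: "sin (w * (1/2)) = 0"
    using sin_npi[of k] by (simp add: w_def mult_ac)
  have sinint: "\<bar>integral {s..t} (\<lambda>x. sin (w * x))\<bar> \<le> 2 / w" if "s \<le> t" for s t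
  proof -
    have "((\<lambda>x. sin (w * x)) has_integral (- cos (w * t) / w - - cos (w * s) / w)) {s..t}"
      using w that by (intro fundamental_theorem_of_calculus)
       (auto intro!: derivative_eq_intros simp flip: has_real_derivative_iff_has_vector_derivative)
    then have "integral {s..t} (\<lambda>x. sin (w * x)) = (cos (w * s) - cos (w * t)) / w"
      using w by (auto simp: integral_unique diff_divide_distrib)
    moreover have "\<bar>cos (w * s) - cos (w * t)\<bar> \<le> 2"
      using abs_cos_le_one[of "w * s"] abs_cos_le_one[of "w * t"] by linarith
    ultimately show ?thesis using w by (simp add: divide_right_mono)
  qed
  have parts: "((\<lambda>x. f x * cos (w * x) + g x * sin (w * x) / w) has_integral
      (f (1/2) * sin (w * (1/2)) / w - f 0 * sin (w * 0) / w)) {0..1/2}"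
    using w
    by (intro fundamental_theorem_of_calculus_interior)
       (auto intro!: derivative_eq_intros continuous_intros f deriv simp: add_divide_distrib
          simp flip: has_real_derivative_iff_has_vector_derivative)
  have fc: "((\<lambda>x. f x * cos (w * x)) has_integral integral {0..1/2} (\<lambda>x. f x * cos (w * x))) {0..1/2}"
    by (intro integrable_integral integrable_continuous_real continuous_intros f)
  have "((\<lambda>x. (f x * cos (w * x) + g x * sin (w * x) / w) - f x * cos (w * x)) has_integral
     (0 - integral {0..1/2} (\<lambda>x. f x * cos (w * x)))) {0..1/2}"
    using has_integral_diff[OF parts fc] sin0 by simp
  then have "((\<lambda>x. w * (g x * sin (w * x) / w)) has_integral
     w * (- integral {0..1/2} (\<lambda>x. f x * cos (w * x)))) {0..1/2}"
    by (intro has_integral_mult_right) simp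
  then have gs: "integral {0..1/2} (\<lambda>x. g x * sin (w * x)) =
     - w * integral {0..1/2} (\<lambda>x. f x * cos (w * x))"
    using w by (simp add: integral_unique)
  obtain c where c: "c \<in> {0..1/2}" "integral {0..1/2} (\<lambda>x. g x * sin (w * x)) =
      g 0 * integral {0..c} (\<lambda>x. sin (w * x)) + g (1/2) * integral {c..1/2} (\<lambda>x. sin (w * x))"
    by (rule second_mean_value_theorem[of "\<lambda>x. sin (w * x)" 0 "1/2" g])
       (use mono in \<open>auto intro!: integrable_continuous_real continuous_intros simp: mono_on_def\<close>)
  have "w * \<bar>integral {0..1/2} (\<lambda>x. f x * cos (w * x))\<bar> = \<bar>integral {0..1/2} (\<lambda>x. g x * sin (w * x))\<bar>"
    using w by (simp add: gs abs_mult)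
  also have "\<dots> \<le> \<bar>g 0\<bar> * (2 / w) + \<bar>g (1/2)\<bar> * (2 / w)"
    unfolding c(2) using c(1)
    by (intro order.trans[OF abs_triangle_ineq] add_mono) (auto simp: abs_mult simp del: times_divide_eq_right intro!: mult_left_mono sinint)
  finally have "\<bar>integral {0..1/2} (\<lambda>x. f x * cos (w * x))\<bar> \<le> 2 * (\<bar>g 0\<bar> + \<bar>g (1/2)\<bar>) / w\<^sup>2"
    using w by (simp add: field_simps power2_eq_square)
  also have "\<dots> \<le> 2 * (\<bar>g 0\<bar> + \<bar>g (1/2)\<bar>) / (2 * real k)\<^sup>2"
    using wk k by (intro divide_left_mono power_mono) auto
  also have "\<dots> \<le> (\<bar>g 0\<bar> + \<bar>g (1/2)\<bar>) / real k ^ 2"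
    using k by (simp add: field_simps)
  finally show ?thesis by (simp add: w_def)
qed

section \<open>The distance from the nearest integer\<close>

lemma dist_nearest_int_attained:
  obtains m :: int where "dist_nearest_int x = \<bar>x - of_int m\<bar>"
proof -
  have "\<int> \<noteq> ({} :: real set)" using Ints_0 by blast
  then obtain y where "y \<in> \<int>" "infdist x \<int> = dist x y"
    using infdist_attains_inf[OF closed_Ints] by blast
  then show ?thesis
    using that by (auto simp: dist_nearest_int_def dist_real_def elim!: Ints_cases)
qed

lemma dist_nearest_int_le: "dist_nearest_int x \<le> \<bar>x - of_int m\<bar>"
  using infdist_le[of "of_int m" \<int> x] by (simp add: dist_nearest_int_def dist_real_def)

lemma dist_nearest_int_nonneg: "dist_nearest_int x \<ge> 0"
  by (simp add: dist_nearest_int_def infdist_nonneg)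

lemma dist_nearest_int_le_half: "dist_nearest_int x \<le> 1/2"
  using dist_nearest_int_le[of x "round x"] of_int_round_abs_le[of x] by linarith

lemma dist_nearest_int_pos:
  assumes "\<alpha> \<notin> \<rat>" "k \<ge> (1::nat)"
  shows "dist_nearest_int (real k * \<alpha>) > 0"
proof (rule ccontr)
  assume "\<not> dist_nearest_int (real k * \<alpha>) > 0"
  moreover obtain m where "dist_nearest_int (real k * \<alpha>) = \<bar>real k * \<alpha> - of_int m\<bar>"
    by (rule dist_nearest_int_attained)
  ultimately have "\<alpha> = of_int m / of_nat k"
    using assms(2) by (simp add: field_simps)
  then show False using assms(1) by (auto simp del: of_int_of_nat_eq)
qed

text \<open>
  The distance from the nearest integer equals $\pm x$ modulo 1, which even 1-periodic functions do not
  notice.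
\<close>

lemma cos_dist_nearest_int:
  "cos (2 * pi * real k * dist_nearest_int x) = cos (2 * pi * real k * x)"
proof -
  obtain m where m: "dist_nearest_int x = \<bar>x - of_int m\<bar>"
    by (rule dist_nearest_int_attained)
  have "cos (2 * pi * real k * dist_nearest_int x) = cos \<bar>2 * pi * real k * (x - of_int m)\<bar>"
    by (simp add: m abs_mult)
  also have "\<dots> = cos (2 * pi * real k * x - 2 * pi * of_int (int k * m))"
    by (simp only: cos_abs_real) (simp add: algebra_simps)
  also have "\<dots> = cos (2 * pi * real k * x)"
    unfolding cos_diff cos_int_2pin sin_int_2pin by simp
  finally show ?thesis .
qed

lemma sin_dist_nearest_int: "\<bar>sin (pi * x)\<bar> = sin (pi * dist_nearest_int x)"
proof -
  have sq: "sin (pi * y) ^ 2 = (1 - cos (2 * pi * y)) / 2" for y :: real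
    using cos_double_sin[of "pi * y"] by (simp add: mult_ac)
  have "sin (pi * x) ^ 2 = sin (pi * dist_nearest_int x) ^ 2"
    using cos_dist_nearest_int[of 1 x] by (simp add: sq)
  then have "\<bar>sin (pi * x)\<bar> = \<bar>sin (pi * dist_nearest_int x)\<bar>"
    by (simp add: power2_eq_iff abs_eq_iff)
  moreover have "sin (pi * dist_nearest_int x) \<ge> 0"
    using dist_nearest_int_le_half[of x] dist_nearest_int_nonneg[of x]
    by (intro sin_ge_zero) (auto simp: mult_left_le)
  ultimately show ?thesis by simp
qed

section \<open>Diophantine condition and small divisors\<close>

text \<open>
  The difference of the two distances is, up to sign, congruent modulo 1 to $(l-k)\alpha$ or to
  $(l+k)\alpha$, depending on whether $k\alpha$ and $l\alpha$ lie on the same side of their nearest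
  integers. The second case is why the lower bound is required up to $2K$.
\<close>

lemma dist_nearest_int_separated:
  fixes \<alpha> \<delta> :: real
  assumes \<delta>: "\<And>q. 1 \<le> q \<Longrightarrow> q \<le> 2 * K \<Longrightarrow> \<delta> \<le> dist_nearest_int (real q * \<alpha>)"
    and "1 \<le> k" "k < l" "l \<le> K"
  shows "\<delta> \<le> \<bar>dist_nearest_int (real k * \<alpha>) - dist_nearest_int (real l * \<alpha>)\<bar>"
proof -
  obtain m where m: "dist_nearest_int (real k * \<alpha>) = \<bar>real k * \<alpha> - of_int m\<bar>"
    by (rule dist_nearest_int_attained)
  obtain n where n: "dist_nearest_int (real l * \<alpha>) = \<bar>real l * \<alpha> - of_int n\<bar>"
    by (rule dist_nearest_int_attained)
  have "\<delta> \<le> \<bar>real (l - k) * \<alpha> - of_int (n - m)\<bar>"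
    by (rule order.trans[OF \<delta> dist_nearest_int_le]) (use assms(2-4) in auto)
  moreover have "\<delta> \<le> \<bar>real (l + k) * \<alpha> - of_int (n + m)\<bar>"
    by (rule order.trans[OF \<delta> dist_nearest_int_le]) (use assms(2-4) in auto)
  ultimately have "\<delta> \<le> \<bar>(real l * \<alpha> - of_int n) - (real k * \<alpha> - of_int m)\<bar>"
    "\<delta> \<le> \<bar>(real l * \<alpha> - of_int n) + (real k * \<alpha> - of_int m)\<bar>"
    using assms(3) by (simp_all add: of_nat_diff algebra_simps)
  then show ?thesis unfolding m n by linarith
qed

text \<open>
  Rounding $x_k/\delta$ down gives distinct positive integers, so the sum is dominated by a part of
  $\sum_m (\delta m)^{-s}$. The term $m = 0$ of the series on the right vanishes because $0$
  raised to any real power by \<open>powr\<close> is $0$.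
\<close>

lemma sum_powr_separated_le:
  fixes x :: "'a \<Rightarrow> real"
  assumes A: "finite A" and \<delta>: "\<delta> > 0" and s: "s > 1"
    and ge: "\<And>k. k \<in> A \<Longrightarrow> \<delta> \<le> x k"
    and sep: "\<And>k l. k \<in> A \<Longrightarrow> l \<in> A \<Longrightarrow> k \<noteq> l \<Longrightarrow> \<delta> \<le> \<bar>x k - x l\<bar>"
  shows "(\<Sum>k\<in>A. x k powr - s) \<le> \<delta> powr - s * (\<Sum>m. real m powr - s)"
proof -
  define m where "m = (\<lambda>k. nat \<lfloor>x k / \<delta>\<rfloor>)"
  have m1: "1 \<le> m k" if "k \<in> A" for k
    using ge[OF that] \<delta> by (simp add: m_def le_nat_iff le_floor_iff)
  have mreal: "real (m k) = of_int \<lfloor>x k / \<delta>\<rfloor>" if "k \<in> A" for k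
    using ge[OF that] \<delta> by (simp add: m_def)
  have lo: "\<delta> * real (m k) \<le> x k" if "k \<in> A" for k
    using floor_divide_lower[OF \<delta>, of "x k"] by (simp add: mreal[OF that] mult.commute)
  have hi: "x k < \<delta> * real (m k) + \<delta>" if "k \<in> A" for k
    using floor_correct[of "x k / \<delta>"] \<delta> by (simp add: mreal[OF that] field_simps)
  have inj: "inj_on m A"
  proof (rule inj_onI, rule ccontr)
    fix k l assume kl: "k \<in> A" "l \<in> A" "m k = m l" "k \<noteq> l"
    show False using sep[OF kl(1,2,4)] lo[OF kl(1)] lo[OF kl(2)] hi[OF kl(1)] hi[OF kl(2)] kl(3)
      by auto
  qed
  have sm: "summable (\<lambda>m. real m powr - s)"
    using s summable_real_powr_iff[of "- s"] by simp
  have "(\<Sum>k\<in>A. x k powr - s) \<le> (\<Sum>k\<in>A. (\<delta> * real (m k)) powr - s)"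
  proof (rule sum_mono)
    fix k assume k: "k \<in> A"
    show "x k powr - s \<le> (\<delta> * real (m k)) powr - s"
      using lo[OF k] m1[OF k] \<delta> s by (intro powr_mono2') auto
  qed
  also have "\<dots> = \<delta> powr - s * (\<Sum>k\<in>m ` A. real k powr - s)"
    using \<delta> inj by (simp add: powr_mult sum_distrib_left sum.reindex)
  also have "\<dots> \<le> \<delta> powr - s * (\<Sum>m. real m powr - s)"
    using A sm by (intro mult_left_mono sum_le_suminf) auto
  finally show ?thesis .
qed

lemma summable_if_dyadic_blocks_geometric:
  fixes b :: "nat \<Rightarrow> real"
  assumes nonneg: "\<And>k. 0 \<le> b k"
    and block: "\<And>j. (\<Sum>k\<in>{2^j..<2^Suc j}. b k) \<le> c * r ^ j"
    and r: "0 \<le> r" "r < 1"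
  shows "summable b"
proof (rule summableI_nonneg_bounded[OF nonneg])
  fix n
  have c: "0 \<le> c"
    using block[of 0] nonneg[of 1] by (simp add: numeral_2_eq_2)
  have "(\<Sum>k<n. b k) \<le> (\<Sum>k<2^n. b k)"
    using nonneg by (intro sum_mono2) (auto intro: less_trans less_exp)
  also have "(\<Sum>k<2^J. b k) \<le> b 0 + (\<Sum>j<J. c * r ^ j)" for J
  proof (induction J)
    case 0
    then show ?case by (simp add: lessThan_Suc)
  next
    case (Suc J)
    have "(\<Sum>k<2^Suc J. b k) = (\<Sum>k<2^J. b k) + (\<Sum>k\<in>{2^J..<2^Suc J}. b k)"
      using sum.atLeastLessThan_concat[of 0 "2^J" "2^Suc J" b] by (simp add: atLeast0LessThan)
    then show ?case using Suc block[of J] by simp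
  qed
  also have "b 0 + (\<Sum>j<n. c * r ^ j) \<le> b 0 + c * (\<Sum>j. r ^ j)"
    using r c unfolding sum_distrib_left[symmetric]
    by (intro add_left_mono mult_left_mono sum_le_suminf summable_geometric) auto
  finally show "(\<Sum>k<n. b k) \<le> b 0 + c * (\<Sum>j. r ^ j)" .
qed

text \<open>
  The obvious choice $s = 1$ would leave a divergent harmonic sum. Raising $1/d_k \ge 1$ to a power
  $s > 1$ only enlarges it, and the cost is small enough as long as $cs < 2$.
\<close>

lemma summable_inverse_square_dist:
  fixes \<alpha> c C :: real
  assumes c: "1 \<le> c" "c < 2" and C: "C > 0"
    and dioph: "\<And>q::nat. q \<ge> 1 \<Longrightarrow> C \<le> real q powr c * dist_nearest_int (real q * \<alpha>)"
  shows "summable (\<lambda>k. 1 / (real k ^ 2 * dist_nearest_int (real k * \<alpha>)))"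
proof -
  \<comment> \<open>The midpoint of the interval between $1$ and $2/c$ of admissible exponents.\<close>
  define s where "s = (1 + 2 / c) / 2"
  define t where "t = (c + 2) / 2"
  have s: "s > 1" using c by (simp add: s_def field_simps)
  have cs: "c * s = t" using c by (simp add: s_def t_def field_simps)
  have t: "0 < t" "t < 2" using c by (auto simp: t_def)
  define Z where "Z = (\<Sum>m. real m powr - s)"
  have lower: "C * real Q powr - c \<le> dist_nearest_int (real q * \<alpha>)" if "1 \<le> q" "q \<le> Q" for q Q
  proof -
    have "C * real Q powr - c \<le> C * real q powr - c"
      using that C c by (intro mult_left_mono powr_mono2') auto
    also have "\<dots> \<le> (real q powr c * dist_nearest_int (real q * \<alpha>)) * real q powr - c"
      using dioph[OF that(1)] by (intro mult_right_mono) auto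
    also have "\<dots> = dist_nearest_int (real q * \<alpha>) * (real q powr c * real q powr - c)"
      by (simp only: mult_ac)
    also have "\<dots> = dist_nearest_int (real q * \<alpha>)"
      using that by (simp flip: powr_add)
    finally show ?thesis .
  qed
  have pos: "0 < dist_nearest_int (real q * \<alpha>)" if "1 \<le> q" for q
  proof -
    have "0 < C * real q powr - c" using C that by simp
    then show ?thesis using lower[OF that, of q] by simp
  qed
  have sumK: "(\<Sum>k\<in>{1..K}. dist_nearest_int (real k * \<alpha>) powr - s)
      \<le> C powr - s * (2 * real K) powr t * Z" if "K \<ge> 1" for K
  proof -
    define \<delta> where "\<delta> = C * real (2 * K) powr - c"
    have "(\<Sum>k\<in>{1..K}. dist_nearest_int (real k * \<alpha>) powr - s) \<le> \<delta> powr - s * Z"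
      unfolding Z_def
    proof (rule sum_powr_separated_le[OF _ _ s])
      show "\<delta> > 0" using C that by (simp add: \<delta>_def)
      show "\<delta> \<le> dist_nearest_int (real k * \<alpha>)" if "k \<in> {1..K}" for k
        unfolding \<delta>_def by (rule lower) (use that in auto)
      have d: "\<delta> \<le> dist_nearest_int (real q * \<alpha>)" if "1 \<le> q" "q \<le> 2 * K" for q
        unfolding \<delta>_def by (rule lower) (use that in auto)
      show "\<delta> \<le> \<bar>dist_nearest_int (real k * \<alpha>) - dist_nearest_int (real l * \<alpha>)\<bar>"
        if "k \<in> {1..K}" "l \<in> {1..K}" "k \<noteq> l" for k l
      proof (cases "k < l")
        case True
        then show ?thesis using dist_nearest_int_separated[where k = k and l = l, OF d] that by auto
      next
        case False
        then show ?thesis using dist_nearest_int_separated[where k = l and l = k, OF d] that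
          by (auto simp: abs_minus_commute)
      qed
    qed auto
    also have "\<delta> powr - s = C powr - s * (2 * real K) powr t"
      using C by (simp add: \<delta>_def powr_mult powr_powr cs)
    finally show ?thesis .
  qed
  show ?thesis
  proof (rule summable_if_dyadic_blocks_geometric)
    show "0 \<le> 1 / (real k ^ 2 * dist_nearest_int (real k * \<alpha>))" for k
      by (simp add: dist_nearest_int_nonneg)
    show "0 \<le> (2::real) powr (t - 2)" "(2::real) powr (t - 2) < 1"
      using t by (auto simp: powr_less_one)
    fix j
    have "(\<Sum>k\<in>{2^j..<2^Suc j}. 1 / (real k ^ 2 * dist_nearest_int (real k * \<alpha>)))
        \<le> (\<Sum>k\<in>{2^j..<2^Suc j}. 1 / (2 ^ j) ^ 2 * dist_nearest_int (real k * \<alpha>) powr - s)"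
    proof (rule sum_mono)
      fix k assume k: "k \<in> {2^j..<2^Suc j::nat}"
      have k1: "1 \<le> k" using k by (metis atLeastLessThan_iff le_trans one_le_numeral one_le_power)
      have k2: "2 ^ j \<le> real k"
        using k by (metis atLeastLessThan_iff of_nat_le_iff of_nat_numeral of_nat_power)
      have "dist_nearest_int (real k * \<alpha>) powr - 1 \<le> dist_nearest_int (real k * \<alpha>) powr - s"
        using dist_nearest_int_le_half[of "real k * \<alpha>"] pos[OF k1] s
        by (intro powr_mono') auto
      then have "1 / dist_nearest_int (real k * \<alpha>) \<le> dist_nearest_int (real k * \<alpha>) powr - s"
        using pos[OF k1] by (simp add: powr_minus_divide)
      moreover have "1 / real k ^ 2 \<le> 1 / (2 ^ j) ^ 2"
        using k2 by (intro divide_left_mono power_mono) (use k1 in auto)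
      ultimately have "1 / real k ^ 2 * (1 / dist_nearest_int (real k * \<alpha>))
          \<le> 1 / (2 ^ j) ^ 2 * dist_nearest_int (real k * \<alpha>) powr - s"
        by (intro mult_mono) (auto simp: dist_nearest_int_nonneg)
      then show "1 / (real k ^ 2 * dist_nearest_int (real k * \<alpha>))
          \<le> 1 / (2 ^ j) ^ 2 * dist_nearest_int (real k * \<alpha>) powr - s" by simp
    qed
    also have "\<dots> = 1 / (2 ^ j) ^ 2 * (\<Sum>k\<in>{2^j..<2^Suc j}. dist_nearest_int (real k * \<alpha>) powr - s)"
      by (simp only: sum_distrib_left)
    also have "\<dots> \<le> 1 / (2 ^ j) ^ 2 * (\<Sum>k\<in>{1..2^Suc j}. dist_nearest_int (real k * \<alpha>) powr - s)"
    proof -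
      have "{2^j..<2^Suc j} \<subseteq> {1..2^Suc j::nat}"
        using one_le_power[of "2::nat" j] by (auto intro: order.trans simp del: one_le_power)
      then show ?thesis by (intro mult_left_mono sum_mono2) auto
    qed
    also have "\<dots> \<le> 1 / (2 ^ j) ^ 2 * (C powr - s * (2 * real (2 ^ Suc j)) powr t * Z)"
      by (intro mult_left_mono sumK) auto
    also have "\<dots> = (C powr - s * 4 powr t * Z) * (2 powr (t - 2)) ^ j"
    proof -
      have "(2 * real (2 ^ Suc j)) powr t = 4 powr t * (2 ^ j) powr t"
        by (simp flip: powr_mult)
      moreover have "(2 ^ j) powr t / (2 ^ j) ^ 2 = (2 powr (t - 2)) ^ j"
      proof -
        have "(2 ^ j) powr t / (2 ^ j) ^ 2 = (2 ^ j :: real) powr (t - 2)"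
          by (simp add: powr_diff)
        also have "\<dots> = (2 powr (t - 2)) ^ j"
          by (simp add: powr_powr mult.commute flip: powr_realpow)
        finally show ?thesis .
      qed
      ultimately show ?thesis by (simp add: field_simps)
    qed
    finally show "(\<Sum>k\<in>{2^j..<2^Suc j}. 1 / (real k ^ 2 * dist_nearest_int (real k * \<alpha>)))
       \<le> (C powr - s * 4 powr t * Z) * (2 powr (t - 2)) ^ j" .
  qed
qed

section \<open>Sums along a rotation\<close>

text \<open>
  Multiplication by $2\sin(\theta/2)$ makes the sum telescope.
\<close>

lemma abs_sum_cos_le:
  fixes \<theta> :: real
  assumes "sin (\<theta> / 2) \<noteq> 0"
  shows "\<bar>\<Sum>n=1..N. cos (real n * \<theta>)\<bar> \<le> 1 / \<bar>sin (\<theta> / 2)\<bar>"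
proof -
  have "2 * sin (\<theta> / 2) * (\<Sum>n=1..N. cos (real n * \<theta>)) = sin ((real N + 1/2) * \<theta>) - sin (\<theta> / 2)"
  proof (induction N)
    case (Suc N)
    have "2 * sin (\<theta> / 2) * cos (real (Suc N) * \<theta>)
        = sin ((real (Suc N) + 1/2) * \<theta>) - sin ((real N + 1/2) * \<theta>)"
    proof -
      have "2 * sin (\<theta> / 2) * cos y = sin (y + \<theta> / 2) - sin (y - \<theta> / 2)" for y
        by (simp add: sin_add sin_diff)
      moreover have "real (Suc N) * \<theta> + \<theta> / 2 = (real (Suc N) + 1/2) * \<theta>"
        "real (Suc N) * \<theta> - \<theta> / 2 = (real N + 1/2) * \<theta>"
        by (simp_all add: algebra_simps)
      ultimately show ?thesis by (simp only:)
    qed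
    then show ?case using Suc by (simp add: algebra_simps)
  qed simp
  from this[symmetric] have "2 * (\<bar>sin (\<theta> / 2)\<bar> * \<bar>\<Sum>n=1..N. cos (real n * \<theta>)\<bar>)
      = \<bar>sin ((real N + 1/2) * \<theta>) - sin (\<theta> / 2)\<bar>"
    by (simp add: abs_mult flip: mult.assoc)
  also have "\<dots> \<le> 2"
    using abs_sin_le_one[of "(real N + 1/2) * \<theta>"] abs_sin_le_one[of "\<theta> / 2"] by linarith
  finally show ?thesis using assms by (simp add: field_simps)
qed

text \<open>
  Expand $f$ in its cosine series and exchange the two summations. Each frequency
  $k$ contributes at most $4|a_k|/|\sin(\pi k\alpha)|$, for every $N$.
\<close>

lemma bounded_sum_along_rotation:
  fixes f :: "real \<Rightarrow> real" and \<alpha> :: real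
  defines "a \<equiv> \<lambda>k::nat. integral {0..1/2} (\<lambda>x. f x * cos (2 * pi * real k * x))"
  assumes f: "continuous_on {0..1/2} f"
    and mean: "integral {0..1/2} f = 0"
    and irr: "\<And>k::nat. k \<ge> 1 \<Longrightarrow> sin (pi * (real k * \<alpha>)) \<noteq> 0"
    and sm: "summable (\<lambda>k. \<bar>a (Suc k)\<bar> / \<bar>sin (pi * (real (Suc k) * \<alpha>))\<bar>)"
  shows "\<exists>B. \<forall>N. \<bar>\<Sum>n=1..N. f (dist_nearest_int (real n * \<alpha>))\<bar> \<le> B"
proof (intro exI allI)
  fix N
  have "\<bar>a (Suc k)\<bar> \<le> \<bar>a (Suc k)\<bar> / \<bar>sin (pi * (real (Suc k) * \<alpha>))\<bar>" for k
    using irr[of "Suc k"] abs_sin_le_one[of "pi * (real (Suc k) * \<alpha>)"]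
    by (intro mult_imp_le_div_pos) (auto simp: mult_left_le)
  then have sma: "summable (\<lambda>k. \<bar>a (Suc k)\<bar>)"
    by (intro summable_comparison_test[OF _ sm]) auto
  have "(\<lambda>k. 4 * a (Suc k) * cos (2 * pi * real (Suc k) * dist_nearest_int (real n * \<alpha>)))
      sums f (dist_nearest_int (real n * \<alpha>))" for n
    unfolding a_def
    by (rule cosine_expansion[OF f mean sma[unfolded a_def]])
       (auto simp: dist_nearest_int_nonneg dist_nearest_int_le_half[simplified])
  then have "(\<lambda>k. \<Sum>n=1..N. 4 * a (Suc k) * cos (2 * pi * real (Suc k) * (real n * \<alpha>)))
      sums (\<Sum>n=1..N. f (dist_nearest_int (real n * \<alpha>)))"
    by (intro sums_sum) (simp only: cos_dist_nearest_int)
  moreover have "(\<Sum>n=1..N. 4 * a (Suc k) * cos (2 * pi * real (Suc k) * (real n * \<alpha>)))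
     = 4 * a (Suc k) * (\<Sum>n=1..N. cos (real n * (2 * (pi * (real (Suc k) * \<alpha>)))))" for k
    by (simp only: sum_distrib_left mult_ac)
  ultimately have sums: "(\<lambda>k. 4 * a (Suc k) * (\<Sum>n=1..N. cos (real n * (2 * (pi * (real (Suc k) * \<alpha>))))))
      sums (\<Sum>n=1..N. f (dist_nearest_int (real n * \<alpha>)))"
    by simp
  have "\<bar>4 * a (Suc k) * (\<Sum>n=1..N. cos (real n * (2 * (pi * (real (Suc k) * \<alpha>)))))\<bar>
      \<le> 4 * (\<bar>a (Suc k)\<bar> / \<bar>sin (pi * (real (Suc k) * \<alpha>))\<bar>)" for k
  proof -
    have "\<bar>\<Sum>n=1..N. cos (real n * (2 * (pi * (real (Suc k) * \<alpha>))))\<bar>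
        \<le> 1 / \<bar>sin (pi * (real (Suc k) * \<alpha>))\<bar>"
      using abs_sum_cos_le[of "2 * (pi * (real (Suc k) * \<alpha>))" N] irr[of "Suc k"] by simp
    from mult_left_mono[OF this, of "4 * \<bar>a (Suc k)\<bar>"] show ?thesis
      by (simp only: abs_mult) simp
  qed
  moreover have sm4: "summable (\<lambda>k. 4 * (\<bar>a (Suc k)\<bar> / \<bar>sin (pi * (real (Suc k) * \<alpha>))\<bar>))"
    using sm by (rule summable_mult)
  ultimately have "norm (\<Sum>k. 4 * a (Suc k) * (\<Sum>n=1..N. cos (real n * (2 * (pi * (real (Suc k) * \<alpha>))))))
     \<le> (\<Sum>k. 4 * (\<bar>a (Suc k)\<bar> / \<bar>sin (pi * (real (Suc k) * \<alpha>))\<bar>))"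
    by (intro norm_suminf_le) auto
  then show "\<bar>\<Sum>n=1..N. f (dist_nearest_int (real n * \<alpha>))\<bar>
     \<le> (\<Sum>k. 4 * (\<bar>a (Suc k)\<bar> / \<bar>sin (pi * (real (Suc k) * \<alpha>))\<bar>))"
    by (simp only: sums_unique[OF sums, symmetric] real_norm_def)
qed

section \<open>The quotient of the sine by the identity\<close>

text \<open>
  The value at $0$ is the limit of the quotient there, which makes the function continuous.
\<close>

definition sin_quotient :: "real \<Rightarrow> real" where
  "sin_quotient x = (if x = 0 then pi else sin (pi * x) / x)"

lemma sin_quotient_mult: "sin_quotient x * x = sin (pi * x)"
  by (simp add: sin_quotient_def)

lemma sin_quotient_pos:
  assumes "x \<in> {0..1/2}"
  shows "sin_quotient x > 0"
proof (cases "x = 0")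
  case False
  then have "sin (pi * x) > 0" using assms by (intro sin_gt_zero) auto
  then show ?thesis using assms False by (simp add: sin_quotient_def)
qed (simp add: sin_quotient_def)

lemma isCont_sin_quotient: "isCont sin_quotient x"
proof (cases "x = 0")
  case True
  have "((\<lambda>x. sin (pi * x)) has_real_derivative pi) (at 0)"
    by (auto intro!: derivative_eq_intros)
  then have "((\<lambda>h. sin (pi * h) / h) \<longlongrightarrow> pi) (at 0)"
    by (simp add: DERIV_def)
  moreover have "eventually (\<lambda>h. sin (pi * h) / h = sin_quotient h) (at (0::real))"
    by (auto simp: eventually_at_filter sin_quotient_def)
  ultimately have "(sin_quotient \<longlongrightarrow> pi) (at 0)"
    by (rule Lim_transform_eventually)
  then show ?thesis using True by (simp add: isCont_def sin_quotient_def)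
next
  case False
  then have "eventually (\<lambda>y. y \<in> - {0}) (nhds x)"
    by (intro eventually_nhds_in_open) auto
  then have "eventually (\<lambda>y. sin_quotient y = sin (pi * y) / y) (nhds x)"
    by eventually_elim (simp add: sin_quotient_def)
  then show ?thesis using False
    by (subst isCont_cong) (auto intro!: continuous_intros)
qed

lemma continuous_on_sin_quotient: "continuous_on A sin_quotient"
  using isCont_sin_quotient continuous_at_imp_continuous_on by blast

text \<open>
  Converts the small divisors $|\sin(\pi k\alpha)|$ into the distances that occur in the
  Diophantine condition. The constant is the minimum of $\sin(\pi x)/x$, positive by compactness.
\<close>

lemma sin_pi_ge_linear: "\<exists>m>0. \<forall>x\<in>{0..1/2}. m * x \<le> sin (pi * x)"
proof -
  obtain z where z: "z \<in> {0..1/2}" "\<forall>y\<in>{0..1/2}. sin_quotient z \<le> sin_quotient y"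
    using continuous_attains_inf[of "{0..1/2}" sin_quotient] continuous_on_sin_quotient by auto
  have "\<forall>x\<in>{0..1/2}. sin_quotient z * x \<le> sin (pi * x)"
    using z by (auto simp flip: sin_quotient_mult intro!: mult_right_mono)
  then show ?thesis using sin_quotient_pos[OF z(1)] by blast
qed

text \<open>
  Euler's duplication argument for the log-sine integral, applied to the continuous function
  $f(x) = \ln(\sin(\pi x)/x)$ so that no improper integrals occur. From
  $\sin(2\pi y) = 2\sin(\pi y)\sin(\pi(1/2-y))$ one gets
  $f(2y) = f(y) + f(1/2-y) + \ln(1/2-y)$ on $[0,1/4]$. Integration gives
  $I/2 = I - 1/4$ for the integral $I$ of $f$ over $[0,1/2]$.
\<close>

lemma has_integral_ln_sin_quotient:
  "((\<lambda>x. ln (sin_quotient x)) has_integral 1/2) {0..1/2}"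
proof -
  define f where "f = (\<lambda>x. ln (sin_quotient x))"
  have contf: "continuous_on {0..1/2} f"
    unfolding f_def using sin_quotient_pos
    by (intro continuous_on_ln continuous_on_sin_quotient) fastforce
  have intf: "f integrable_on {s..t}" if "0 \<le> s" "t \<le> 1/2" for s t
    using continuous_on_subset[OF contf, of "{s..t}"] that by (auto intro: integrable_continuous_real)
  define I where "I = integral {0..1/2} f"
  have I: "(f has_integral I) {0..1/2}"
    unfolding I_def by (intro integrable_integral intf) auto
  have split: "integral {0..1/4} f + integral {1/4..1/2} f = I"
    unfolding I_def by (intro Henstock_Kurzweil_Integration.integral_combine intf) auto
  have double: "((\<lambda>y. f (2 * y)) has_integral I / 2) {0..1/4}"
    using has_integral_affinity'[of f I 0 "1/2" 2 0] I by simp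
  have left: "(f has_integral integral {0..1/4} f) {0..1/4}"
    by (intro integrable_integral intf) auto
  have "(f has_integral integral {1/4..1/2} f) {1/4..1/2}"
    by (intro integrable_integral intf) auto
  then have right: "((\<lambda>y. f (1/2 - y)) has_integral integral {1/4..1/2} f) {0..1/4}"
    using has_integral_affinity[of f "integral {1/4..1/2} f" "1/4" "1/2" "-1" "1/2"]
    by (simp add: image_affinity_atLeastAtMost_diff)
  have log: "((\<lambda>y. ln (1/2 - y)) has_integral - 1/4) {0..1/4::real}"
  proof -
    have "((\<lambda>y. ln (1/2 - y)) has_integral
       (((1/2 - 1/4) - (1/2 - 1/4) * ln (1/2 - 1/4)) - ((1/2 - 0) - (1/2 - 0) * ln (1/2 - 0))))
       {0..1/4::real}"
      by (intro fundamental_theorem_of_calculus)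
         (auto intro!: derivative_eq_intros simp flip: has_real_derivative_iff_has_vector_derivative)
    moreover have "ln (1/4::real) = - 2 * ln 2"
      using ln_realpow[of 2 2] by (simp add: ln_div)
    ultimately show ?thesis by (simp add: ln_div)
  qed
  have dup: "f (2 * y) = f y + f (1/2 - y) + ln (1/2 - y)" if y: "y \<in> {0..1/4}" for y
  proof -
    have "sin_quotient (2 * y) = sin_quotient y * cos (pi * y)"
      using sin_double[of "pi * y"] by (auto simp: sin_quotient_def mult_ac)
    also have "cos (pi * y) = sin_quotient (1/2 - y) * (1/2 - y)"
      unfolding sin_quotient_mult cos_sin_eq[of "pi * y"] by (simp add: right_diff_distrib)
    finally have eq: "sin_quotient (2 * y) = sin_quotient y * (sin_quotient (1/2 - y) * (1/2 - y))" .
    show ?thesis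
      unfolding f_def eq using y sin_quotient_pos[of y] sin_quotient_pos[of "1/2 - y"]
      by (simp add: ln_mult_pos)
  qed
  have "((\<lambda>y. f y + f (1/2 - y) + ln (1/2 - y)) has_integral I - 1/4) {0..1/4}"
    using has_integral_add[OF has_integral_add[OF left right] log] split by simp
  then have "((\<lambda>y. f (2 * y)) has_integral I - 1/4) {0..1/4}"
    using dup by (subst has_integral_cong) auto
  then have "I / 2 = I - 1/4" using double has_integral_unique by blast
  then have "I = 1/2" by simp
  then show ?thesis using I unfolding f_def by (simp only:)
qed

text \<open>
  The derivative of $1 - \ln(\sin(\pi x)/x)$. The value at $0$ is its limit there, so that the function
  is monotone on the closed interval $[0,1/2]$.
\<close>

definition reciprocal_minus_pi_cot :: "real \<Rightarrow> real" where
  "reciprocal_minus_pi_cot x = (if x = 0 then 0 else 1 / x - pi * cot (pi * x))"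

lemma has_real_derivative_one_minus_ln_sin_quotient:
  assumes x: "x \<in> {0<..<1/2}"
  shows "((\<lambda>x. 1 - ln (sin_quotient x)) has_real_derivative reciprocal_minus_pi_cot x) (at x)"
proof -
  have s: "sin (pi * x) > 0" using x by (intro sin_gt_zero) auto
  have "((\<lambda>x. 1 - (ln (sin (pi * x)) - ln x)) has_real_derivative 1 / x - pi * cot (pi * x)) (at x)"
    using s x by (auto intro!: derivative_eq_intros simp: cot_def)
  then have "((\<lambda>x. 1 - ln (sin_quotient x)) has_real_derivative 1 / x - pi * cot (pi * x)) (at x)"
  proof (rule has_field_derivative_transform_within_open)
    fix y :: real assume y: "y \<in> {0<..<1/2}"
    have "sin (pi * y) > 0" using y by (intro sin_gt_zero) auto
    then show "1 - (ln (sin (pi * y)) - ln y) = 1 - ln (sin_quotient y)"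
      using y by (simp add: sin_quotient_def ln_div)
  qed (use x in auto)
  then show ?thesis using x by (simp add: reciprocal_minus_pi_cot_def)
qed

text \<open>
  For positive arguments the derivative $\pi^2/\sin^2(\pi z) - 1/z^2$ is nonnegative because
  $\sin t \le t$. Comparison with the value at $0$ amounts to $t\cos t \le \sin t$.
\<close>

lemma mono_on_reciprocal_minus_pi_cot: "mono_on {0..1/2} reciprocal_minus_pi_cot"
proof (rule mono_onI)
  fix x y :: real assume xy: "x \<in> {0..1/2}" "y \<in> {0..1/2}" "x \<le> y"
  have sinpos: "sin (pi * z) > 0" if "0 < z" "z \<le> 1/2" for z
    using that by (intro sin_gt_zero) auto
  consider "y = 0" | "x = 0" "y > 0" | "x > 0" using xy by fastforce
  then show "reciprocal_minus_pi_cot x \<le> reciprocal_minus_pi_cot y"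
  proof cases
    case 1
    then show ?thesis using xy by simp
  next
    case 2
    have "sin 0 - 0 * cos 0 \<le> sin (pi * y) - (pi * y) * cos (pi * y)"
    proof (rule DERIV_nonneg_imp_nondecreasing[where f = "\<lambda>t. sin t - t * cos t"])
      fix t assume t: "0 \<le> t" "t \<le> pi * y"
      have "pi * y \<le> pi" using xy by simp
      then have "t \<le> pi" using t(2) by (rule order.trans[rotated])
      then have "0 \<le> t * sin t" using t(1) by (intro mult_nonneg_nonneg sin_ge_zero)
      moreover have "((\<lambda>t. sin t - t * cos t) has_real_derivative t * sin t) (at t)"
        by (auto intro!: derivative_eq_intros)
      ultimately show "\<exists>D. ((\<lambda>t. sin t - t * cos t) has_real_derivative D) (at t) \<and> 0 \<le> D"
        by blast
    qed (use 2 in auto)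
    then have "0 \<le> 1 / y - pi * cot (pi * y)"
      using sinpos[of y] xy 2 by (simp add: cot_def field_simps)
    then show ?thesis using 2 by (simp add: reciprocal_minus_pi_cot_def)
  next
    case 3
    have "1 / x - pi * cot (pi * x) \<le> 1 / y - pi * cot (pi * y)"
    proof (rule DERIV_nonneg_imp_nondecreasing[OF xy(3)])
      fix z assume z: "x \<le> z" "z \<le> y"
      have z0: "z > 0" "z \<le> 1/2" using 3 xy z by auto
      note s = sinpos[OF z0]
      have "sin (pi * z) ^ 2 \<le> (pi * z) ^ 2"
        using s z0 by (intro power_mono sin_x_le_x) auto
      then have "pi ^ 2 / (sin (pi * z)) ^ 2 - 1 / z ^ 2 \<ge> 0"
        using s z0 by (simp add: field_simps)
      moreover have "((\<lambda>z. 1 / z - pi * cot (pi * z)) has_real_derivative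
          pi ^ 2 / (sin (pi * z)) ^ 2 - 1 / z ^ 2) (at z)"
      proof -
        have "((\<lambda>z. 1 / z) has_real_derivative - (1 / z ^ 2)) (at z)"
          using z0 by (auto intro!: derivative_eq_intros simp: power2_eq_square)
        moreover have "((\<lambda>z. cot (pi * z)) has_real_derivative - inverse ((sin (pi * z)) ^ 2) * pi) (at z)"
          by (rule DERIV_chain2[OF DERIV_cot]) (use s in \<open>auto intro!: derivative_eq_intros\<close>)
        ultimately have "((\<lambda>z. 1 / z - pi * cot (pi * z)) has_real_derivative
            - (1 / z ^ 2) - pi * (- inverse ((sin (pi * z)) ^ 2) * pi)) (at z)"
          by (intro DERIV_diff DERIV_cmult)
        moreover have "- (1 / z ^ 2) - pi * (- inverse ((sin (pi * z)) ^ 2) * pi)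
            = pi ^ 2 / (sin (pi * z)) ^ 2 - 1 / z ^ 2"
          by (simp add: power2_eq_square field_simps)
        ultimately show ?thesis by (simp only:)
      qed
      ultimately show "\<exists>D. ((\<lambda>z. 1 / z - pi * cot (pi * z)) has_real_derivative D) (at z) \<and> 0 \<le> D"
        by blast
    qed
    then show ?thesis using 3 xy by (simp add: reciprocal_minus_pi_cot_def)
  qed
qed

section \<open>Comparison of the two products\<close>

lemma diophantine_of_INF:
  fixes \<alpha> c :: real
  assumes "(INF q\<in>{1::nat..}. real q powr c * dist_nearest_int (real q * \<alpha>)) > 0"
  shows "\<exists>C>0. \<forall>q\<ge>1. C \<le> real q powr c * dist_nearest_int (real q * \<alpha>)"
proof (intro exI conjI allI impI)
  show "(INF q\<in>{1::nat..}. real q powr c * dist_nearest_int (real q * \<alpha>)) > 0" by fact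
  fix q :: nat assume "1 \<le> q"
  moreover have "bdd_below ((\<lambda>q. real q powr c * dist_nearest_int (real q * \<alpha>)) ` {1::nat..})"
    by (intro bdd_belowI[of _ 0]) (auto simp: dist_nearest_int_nonneg)
  ultimately show "(INF q\<in>{1::nat..}. real q powr c * dist_nearest_int (real q * \<alpha>))
      \<le> real q powr c * dist_nearest_int (real q * \<alpha>)"
    by (intro cINF_lower) auto
qed

text \<open>
  Factor by factor, $2ed = 2\sin(\pi d)\cdot e\,d/\sin(\pi d)$. Both sides vanish if some $d$ is $0$.
\<close>

lemma prod_dist_nearest_int_eq_sudler_product:
  "(\<Prod>n=1..N. 2 * exp 1 * dist_nearest_int (real n * \<alpha>)) =
     sudler_product N \<alpha> * exp (\<Sum>n=1..N. 1 - ln (sin_quotient (dist_nearest_int (real n * \<alpha>))))"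
proof -
  have "2 * exp 1 * dist_nearest_int (real n * \<alpha>) = \<bar>2 * sin (pi * real n * \<alpha>)\<bar>
      * exp (1 - ln (sin_quotient (dist_nearest_int (real n * \<alpha>))))" for n
  proof -
    let ?d = "dist_nearest_int (real n * \<alpha>)"
    have "sin_quotient ?d > 0"
      using dist_nearest_int_le_half dist_nearest_int_nonneg by (intro sin_quotient_pos) auto
    then have "exp (1 - ln (sin_quotient ?d)) = exp 1 / sin_quotient ?d" "sin_quotient ?d \<noteq> 0"
      by (auto simp: exp_diff)
    moreover have "\<bar>2 * sin (pi * real n * \<alpha>)\<bar> = 2 * (sin_quotient ?d * ?d)"
      using sin_dist_nearest_int[of "real n * \<alpha>"] by (simp add: abs_mult sin_quotient_mult mult.assoc)
    ultimately show ?thesis by simp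
  qed
  then show ?thesis
    by (simp only: sudler_product_def exp_sum finite_atLeastAtMost prod.distrib)
qed

theorem proposition12:
  fixes \<alpha> :: real
  assumes "\<alpha> \<notin> \<rat>"
    and "\<exists>c::real. 1 \<le> c \<and> c < 2 \<and>
           (INF q\<in>{1::nat..}. real q powr c * dist_nearest_int (real q * \<alpha>)) > 0"
  shows "(\<exists>C>0. \<forall>N\<ge>1. \<bar>sudler_product N \<alpha>\<bar>
             \<le> C * (\<Prod>n=1..N. 2 * exp 1 * dist_nearest_int (real n * \<alpha>)))
       \<and> (\<exists>C>0. \<forall>N\<ge>1. \<bar>\<Prod>n=1..N. 2 * exp 1 * dist_nearest_int (real n * \<alpha>)\<bar>
             \<le> C * sudler_product N \<alpha>)"
proof -
  define f where "f = (\<lambda>x. 1 - ln (sin_quotient x))"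
  define a where "a = (\<lambda>k::nat. integral {0..1/2} (\<lambda>x. f x * cos (2 * pi * real k * x)))"
  obtain c C where c: "1 \<le> c" "c < 2" and C: "C > 0"
    "\<And>q::nat. q \<ge> 1 \<Longrightarrow> C \<le> real q powr c * dist_nearest_int (real q * \<alpha>)"
    using assms(2) diophantine_of_INF by metis
  obtain m where m: "m > 0" "\<And>x. x \<in> {0..1/2} \<Longrightarrow> m * x \<le> sin (pi * x)"
    using sin_pi_ge_linear by blast
  have sin_ge: "m * dist_nearest_int x \<le> \<bar>sin (pi * x)\<bar>" for x
    unfolding sin_dist_nearest_int
    using dist_nearest_int_le_half dist_nearest_int_nonneg by (intro m(2)) auto
  have pos: "0 < dist_nearest_int (real k * \<alpha>)" if "k \<ge> 1" for k :: nat
    by (rule dist_nearest_int_pos[OF assms(1) that])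
  have contf: "continuous_on {0..1/2} f"
    unfolding f_def using sin_quotient_pos
    by (intro continuous_on_diff continuous_on_const continuous_on_ln continuous_on_sin_quotient)
       fastforce
  define M where "M = \<bar>reciprocal_minus_pi_cot 0\<bar> + \<bar>reciprocal_minus_pi_cot (1/2)\<bar>"
  have coeff: "\<bar>a k\<bar> \<le> M / real k ^ 2" if "k \<ge> 1" for k
    unfolding a_def M_def
    by (rule cosine_coefficient_bound[OF contf _ mono_on_reciprocal_minus_pi_cot that])
       (unfold f_def, rule has_real_derivative_one_minus_ln_sin_quotient)
  have "\<exists>B. \<forall>N. \<bar>\<Sum>n=1..N. f (dist_nearest_int (real n * \<alpha>))\<bar> \<le> B"
  proof (rule bounded_sum_along_rotation[OF contf])
    have "(f has_integral (1/2 - 1/2)) {0..1/2}"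
      unfolding f_def
      using has_integral_diff[OF has_integral_const_real[of 1 0 "1/2"] has_integral_ln_sin_quotient]
      by simp
    then show "integral {0..1/2} f = 0" by (simp add: integral_unique)
    show "sin (pi * (real k * \<alpha>)) \<noteq> 0" if "1 \<le> k" for k
      using sin_ge[of "real k * \<alpha>"] mult_pos_pos[OF m(1) pos[OF that]] by auto
    have "summable (\<lambda>k. M / m * (1 / (real (Suc k) ^ 2 * dist_nearest_int (real (Suc k) * \<alpha>))))"
      using summable_inverse_square_dist[OF c C] by (intro summable_mult) (subst summable_Suc_iff)
    then have "summable (\<lambda>k. \<bar>a (Suc k)\<bar> / \<bar>sin (pi * (real (Suc k) * \<alpha>))\<bar>)"
    proof (rule summable_comparison_test'[where N = 0])
      fix k
      have "norm (\<bar>a (Suc k)\<bar> / \<bar>sin (pi * (real (Suc k) * \<alpha>))\<bar>)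
          = \<bar>a (Suc k)\<bar> / \<bar>sin (pi * (real (Suc k) * \<alpha>))\<bar>"
        by (simp only: real_norm_def abs_divide abs_abs)
      also have "\<dots> \<le> (M / real (Suc k) ^ 2) / (m * dist_nearest_int (real (Suc k) * \<alpha>))"
        by (intro frac_le coeff sin_ge mult_pos_pos m pos) (auto simp: M_def)
      also have "\<dots> = M / m * (1 / (real (Suc k) ^ 2 * dist_nearest_int (real (Suc k) * \<alpha>)))"
        by (simp only: times_divide_times_eq divide_divide_eq_left mult_1_right mult_ac)
      finally show "norm (\<bar>a (Suc k)\<bar> / \<bar>sin (pi * (real (Suc k) * \<alpha>))\<bar>)
          \<le> M / m * (1 / (real (Suc k) ^ 2 * dist_nearest_int (real (Suc k) * \<alpha>)))" .
    qed
    then show "summable (\<lambda>k. \<bar>integral {0..1/2} (\<lambda>x. f x * cos (2 * pi * real (Suc k) * x))\<bar> /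
        \<bar>sin (pi * (real (Suc k) * \<alpha>))\<bar>)"
      unfolding a_def .
  qed
  then obtain B where B: "\<And>N. \<bar>\<Sum>n=1..N. f (dist_nearest_int (real n * \<alpha>))\<bar> \<le> B"
    by blast
  define S where "S = (\<lambda>N. \<Sum>n=1..N. f (dist_nearest_int (real n * \<alpha>)))"
  have S: "S N \<le> B" "- S N \<le> B" for N
    using B[of N] by (auto simp: S_def)
  have prod: "(\<Prod>n=1..N. 2 * exp 1 * dist_nearest_int (real n * \<alpha>)) = sudler_product N \<alpha> * exp (S N)" for N
    using prod_dist_nearest_int_eq_sudler_product by (simp add: S_def f_def)
  have P: "sudler_product N \<alpha> \<ge> 0" for N
    unfolding sudler_product_def by (intro prod_nonneg) auto
  have "\<bar>sudler_product N \<alpha>\<bar> \<le> exp B * (sudler_product N \<alpha> * exp (S N))" for N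
  proof -
    have "\<bar>sudler_product N \<alpha>\<bar> = exp (- S N) * (sudler_product N \<alpha> * exp (S N))"
      using P[of N] by (simp add: exp_minus)
    also have "\<dots> \<le> exp B * (sudler_product N \<alpha> * exp (S N))"
      using S[of N] P[of N] by (intro mult_right_mono) auto
    finally show ?thesis .
  qed
  moreover have "\<bar>sudler_product N \<alpha> * exp (S N)\<bar> \<le> exp B * sudler_product N \<alpha>" for N
  proof -
    have "\<bar>sudler_product N \<alpha> * exp (S N)\<bar> = exp (S N) * sudler_product N \<alpha>"
      using P[of N] by simp
    also have "\<dots> \<le> exp B * sudler_product N \<alpha>"
      using S[of N] P[of N] by (intro mult_right_mono) auto
    finally show ?thesis .
  qed
  ultimately show ?thesis
    unfolding prod by (intro conjI exI[of _ "exp B"]) simp_all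
qed

end
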